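(* Let $A$ and $B$ be bases of a rank-$r$ matroid $M$ that has property (P+). Then there exist orderings $(a_1,\dots,a_r)$ and $(b_1,\dots,b_r)$ of the elements of $A$ and $B$, respectively, such that, in the cyclic ordering $(a_1,\dots,a_r,b_1,\dots,b_r)$, the set $\{a_i,\dots,a_r,b_1,\dots,b_{i-1}\}$ is a basis for every $i=1,\dots,r$, and the set $\{b_i,\dots,b_r,a_1,\dots,a_{i-1}\}$ has rank at least $r-1$ for every $i=1,\dots,r$.
   Context: For a matroid with circuit set $\mathcal{C}$ and a subset $X$ of the ground set, $\mathcal{C}[X]$ is the set of circuits contained in $X$. A path whose vertex set is a set of matroid elements covers a family of circuits if every circuit of the family contains both endpoints of some edge of the path. A matroid has property (P+) if for any pair $A,B$ of bases there exists a path with vertex set $A\triangle B$ alternating between $A\setminus B$ and $B\setminus A$ that covers $\mathcal{C}[A\cup B]$. *)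

theory Defs
  imports Main
begin

locale matroid =
  fixes E :: "'a set" and indep :: "'a set \<Rightarrow> bool"
  assumes finite_ground: "finite E"
    and indep_subset_ground: "indep X \<Longrightarrow> X \<subseteq> E"
    and indep_empty: "indep {}"
    and indep_subset: "indep X \<Longrightarrow> Y \<subseteq> X \<Longrightarrow> indep Y"
    and augmentation:
      "indep X \<Longrightarrow> indep Y \<Longrightarrow> card X < card Y \<Longrightarrow> \<exists>y \<in> Y - X. indep (insert y X)"

definition matroid_basis :: "'a set \<Rightarrow> ('a set \<Rightarrow> bool) \<Rightarrow> 'a set \<Rightarrow> bool" where
  "matroid_basis E indep B \<longleftrightarrow>
     B \<subseteq> E \<and> indep B \<and> (\<forall>X. X \<subseteq> E \<longrightarrow> B \<subset> X \<longrightarrow> \<not> indep X)"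

definition matroid_circuit :: "'a set \<Rightarrow> ('a set \<Rightarrow> bool) \<Rightarrow> 'a set \<Rightarrow> bool" where
  "matroid_circuit E indep C \<longleftrightarrow>
     C \<subseteq> E \<and> \<not> indep C \<and> (\<forall>X. X \<subset> C \<longrightarrow> indep X)"

definition circuits_in :: "'a set \<Rightarrow> ('a set \<Rightarrow> bool) \<Rightarrow> 'a set \<Rightarrow> 'a set set" where
  "circuits_in E indep X = {C. matroid_circuit E indep C \<and> C \<subseteq> X}"

definition matroid_rank :: "('a set \<Rightarrow> bool) \<Rightarrow> 'a set \<Rightarrow> nat" where
  "matroid_rank indep X = Max (card ` {Y. Y \<subseteq> X \<and> indep Y})"

text \<open>A path is given by the list of its vertices; its edges are the pairs of consecutive
  entries. The empty list is the path on the empty vertex set, as needed for two equal bases.\<close>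

definition alternating_path :: "'a set \<Rightarrow> 'a set \<Rightarrow> 'a list \<Rightarrow> bool" where
  "alternating_path S T p \<longleftrightarrow>
     distinct p \<and> set p \<subseteq> S \<union> T \<and>
     (\<forall>i. Suc i < length p \<longrightarrow>
        (p ! i \<in> S \<and> p ! Suc i \<in> T) \<or> (p ! i \<in> T \<and> p ! Suc i \<in> S))"

definition path_covers :: "'a list \<Rightarrow> 'a set set \<Rightarrow> bool" where
  "path_covers p F \<longleftrightarrow>
     (\<forall>C \<in> F. \<exists>i. Suc i < length p \<and> p ! i \<in> C \<and> p ! Suc i \<in> C)"

definition property_P_plus :: "'a set \<Rightarrow> ('a set \<Rightarrow> bool) \<Rightarrow> bool" where
  "property_P_plus E indep \<longleftrightarrow>
     (\<forall>A B. matroid_basis E indep A \<longrightarrow> matroid_basis E indep B \<longrightarrow>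
        (\<exists>p. set p = sym_diff A B \<and> alternating_path (A - B) (B - A) p \<and>
             path_covers p (circuits_in E indep (A \<union> B))))"

end

theory Submission
  imports Defs
begin

text \<open>By (P+), a subset of \<open>A \<union> B\<close> containing no edge of the path is independent. Orient the
  path as \<open>y\<^sub>1, x\<^sub>1, y\<^sub>2, x\<^sub>2, \<dots>, y\<^sub>k, x\<^sub>k\<close> with \<open>y\<^sub>j \<in> B - A\<close> and \<open>x\<^sub>j \<in> A - B\<close>, and order both
  bases by listing \<open>A \<inter> B\<close> first, in the same order, followed by the \<open>x\<^sub>j\<close> and the \<open>y\<^sub>j\<close>,
  respectively. Then \<open>{a\<^sub>i, \<dots>, a\<^sub>r, b\<^sub>1, \<dots>, b\<^sub>i\<^sub>-\<^sub>1}\<close> contains no edge, while the only edge that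
  \<open>{b\<^sub>i, \<dots>, b\<^sub>r, a\<^sub>1, \<dots>, a\<^sub>i\<^sub>-\<^sub>1}\<close> can contain joins \<open>a\<^sub>i\<^sub>-\<^sub>1\<close> to \<open>b\<^sub>i\<close>, so deleting \<open>b\<^sub>i\<close> leaves an
  independent set of size \<open>r - 1\<close>.\<close>

section \<open>Bases, rank and circuits of a matroid\<close>

context matroid
begin

lemma finite_indep: "indep X \<Longrightarrow> finite X"
  using indep_subset_ground finite_ground finite_subset by blast

lemma card_le_rank:
  assumes "Y \<subseteq> X" "X \<subseteq> E" "indep Y"
  shows "card Y \<le> matroid_rank indep X"
proof -
  have "finite X" using assms(2) finite_ground finite_subset by blast
  then show ?thesis
    unfolding matroid_rank_def using assms by (intro Max_ge) auto
qed

text \<open>A larger independent set would, by augmentation, enlarge a maximal one.\<close>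

lemma card_basis_eq_rank:
  assumes "matroid_basis E indep B"
  shows "card B = matroid_rank indep E"
proof (rule antisym)
  have B: "B \<subseteq> E" "indep B" and maximal: "\<And>X. X \<subseteq> E \<Longrightarrow> B \<subset> X \<Longrightarrow> \<not> indep X"
    using assms by (auto simp: matroid_basis_def)
  show "card B \<le> matroid_rank indep E"
    using B by (intro card_le_rank) auto
  have "card Y \<le> card B" if Y: "indep Y" for Y
  proof (rule ccontr)
    assume "\<not> card Y \<le> card B"
    then obtain y where "y \<in> Y - B" "indep (insert y B)"
      using augmentation[OF B(2) Y] by auto
    then show False
      using maximal[of "insert y B"] indep_subset_ground[of "insert y B"] by auto
  qed
  then show "matroid_rank indep E \<le> card B"
    unfolding matroid_rank_def using finite_ground B
    by (subst Max_le_iff) auto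
qed

lemma basis_if_card_eq_rank:
  assumes "indep X" "card X = matroid_rank indep E"
  shows "matroid_basis E indep X"
  unfolding matroid_basis_def
proof (intro conjI allI impI notI)
  show "X \<subseteq> E" using assms(1) by (rule indep_subset_ground)
  show "indep X" by fact
  fix Y assume "Y \<subseteq> E" "X \<subset> Y" "indep Y"
  then have "card X < card Y"
    using finite_indep psubset_card_mono by blast
  moreover have "card Y \<le> matroid_rank indep E"
    using \<open>Y \<subseteq> E\<close> \<open>indep Y\<close> by (intro card_le_rank) auto
  ultimately show False using assms(2) by simp
qed

lemma dependent_contains_circuit:
  assumes "X \<subseteq> E" "\<not> indep X"
  shows "\<exists>C \<subseteq> X. matroid_circuit E indep C"
proof -
  have "finite X" using assms(1) finite_ground finite_subset by blast
  then show ?thesis using assms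
  proof (induction X rule: finite_psubset_induct)
    case (psubset X)
    show ?case
    proof (cases "\<forall>Y. Y \<subset> X \<longrightarrow> indep Y")
      case True
      then show ?thesis using psubset.prems by (auto simp: matroid_circuit_def)
    next
      case False
      then obtain Y where "Y \<subset> X" "\<not> indep Y" by blast
      then show ?thesis using psubset.IH[of Y] psubset.prems by blast
    qed
  qed
qed

text \<open>The bridge from covering to independence: a dependent \<open>S\<close> contains a
  circuit, the path covers it by an edge, and both ends of that edge lie in
  \<open>S\<close>.\<close>

lemma indep_if_edge_free:
  assumes "path_covers p (circuits_in E indep X)" "X \<subseteq> E" "S \<subseteq> X"
    and edge_free: "\<And>j. Suc j < length p \<Longrightarrow> p ! j \<in> S \<Longrightarrow> p ! Suc j \<in> S \<Longrightarrow> False"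
  shows "indep S"
proof (rule ccontr)
  assume "\<not> indep S"
  then obtain C where "C \<subseteq> S" "matroid_circuit E indep C"
    using dependent_contains_circuit[OF subset_trans[OF assms(3,2)]] by blast
  then have "C \<in> circuits_in E indep X"
    using assms(3) by (auto simp: circuits_in_def)
  then obtain j where "Suc j < length p" "p ! j \<in> C" "p ! Suc j \<in> C"
    using assms(1) by (auto simp: path_covers_def)
  then show False
    using edge_free[of j] \<open>C \<subseteq> S\<close> by blast
qed

end

section \<open>Reversal and parity of alternating paths\<close>

lemma alternating_path_rev:
  assumes "alternating_path S T p"
  shows "alternating_path S T (rev p)"
proof -
  have "(rev p ! i \<in> S \<and> rev p ! Suc i \<in> T) \<or> (rev p ! i \<in> T \<and> rev p ! Suc i \<in> S)"
    if "Suc i < length p" for i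
  proof -
    \<comment> \<open>Edge \<open>i\<close> of \<open>rev p\<close> is edge \<open>?j\<close> of
      \<open>p\<close> traversed backwards.\<close>
    let ?j = "length p - Suc (Suc i)"
    have "rev p ! i = p ! Suc ?j" "rev p ! Suc i = p ! ?j"
      using that by (simp_all add: rev_nth Suc_diff_Suc)
    moreover have "Suc ?j < length p" using that by simp
    ultimately show ?thesis
      using assms unfolding alternating_path_def by metis
  qed
  then show ?thesis
    using assms by (simp add: alternating_path_def)
qed

lemma path_covers_rev:
  assumes "path_covers p F"
  shows "path_covers (rev p) F"
  unfolding path_covers_def
proof
  fix C assume "C \<in> F"
  then obtain i where i: "Suc i < length p" "p ! i \<in> C" "p ! Suc i \<in> C"
    using assms by (auto simp: path_covers_def)
  let ?j = "length p - Suc (Suc i)"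
  have "rev p ! ?j = p ! Suc i" "rev p ! Suc ?j = p ! i" "Suc ?j < length p"
    using i(1) by (simp_all add: rev_nth Suc_diff_Suc)
  then show "\<exists>j. Suc j < length (rev p) \<and> rev p ! j \<in> C \<and> rev p ! Suc j \<in> C"
    using i by (intro exI[of _ ?j]) simp
qed

text \<open>Disjointness of \<open>S\<close> and \<open>T\<close> makes the two alternatives for an
  edge exclusive, so the side of the first vertex determines all others.\<close>

lemma alternating_path_parity:
  assumes "alternating_path S T p" "S \<inter> T = {}" "p ! 0 \<in> T" "j < length p"
  shows "if even j then p ! j \<in> T else p ! j \<in> S"
  using assms(4)
proof (induction j)
  case 0
  then show ?case using assms(3) by simp
next
  case (Suc j)
  then have "(p ! j \<in> S \<and> p ! Suc j \<in> T) \<or> (p ! j \<in> T \<and> p ! Suc j \<in> S)"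
    using assms(1) by (simp add: alternating_path_def)
  then show ?case using Suc assms(2) by (auto split: if_splits)
qed

lemma alternating_path_even_length:
  assumes "alternating_path S T p" "set p = S \<union> T" "S \<inter> T = {}" "card S = card T" "p ! 0 \<in> T"
  shows "length p = 2 * card S"
proof -
  have "distinct p" using assms(1) by (simp add: alternating_path_def)
  then have "length p = card (S \<union> T)" using assms(2) distinct_card by metis
  moreover have "finite (S \<union> T)" using assms(2) by (metis List.finite_set)
  ultimately show ?thesis using assms(3,4) by (simp add: card_Un_disjoint)
qed

text \<open>Supplies the orientation starting in \<open>T\<close>. The length is even, so the two
  ends of a nonempty path lie on different sides and either \<open>p\<close> or \<open>rev p\<close>
  starts in \<open>T\<close>.\<close>

lemma alternating_path_from_right:
  assumes "alternating_path S T p" "set p = S \<union> T" "S \<inter> T = {}" "card S = card T"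
    "path_covers p F"
  obtains q where "alternating_path S T q" "set q = S \<union> T" "path_covers q F"
    "length q = 2 * card S" "\<And>j. j < length q \<Longrightarrow> if even j then q ! j \<in> T else q ! j \<in> S"
proof (cases "p = []")
  case True
  then have "S = {}" "T = {}" using assms(2) by auto
  then show thesis using that[of p] True assms by simp
next
  case nonempty: False
  have "\<exists>q. alternating_path S T q \<and> set q = S \<union> T \<and> path_covers q F \<and> q ! 0 \<in> T"
  proof (cases "p ! 0 \<in> T")
    case True
    then show ?thesis using assms by blast
  next
    case False
    have "p ! 0 \<in> S" using False nonempty assms(2) by (metis UnE length_greater_0_conv nth_mem)
    \<comment> \<open>With the roles of \<open>S\<close> and \<open>T\<close> exchanged, the parity
      lemma applies to a path starting in \<open>S\<close>; its last position is odd, hence in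
      \<open>T\<close>.\<close>
    have "alternating_path T S p"
      using assms(1) by (auto simp: alternating_path_def)
    note parity = alternating_path_parity[OF this _ \<open>p ! 0 \<in> S\<close>]
    have len: "length p = 2 * card T"
      using \<open>alternating_path T S p\<close> \<open>p ! 0 \<in> S\<close> assms
      by (intro alternating_path_even_length) auto
    moreover have "0 < length p" using nonempty by simp
    ultimately have "length p - 1 < length p" "odd (length p - 1)" by simp_all
    then have "p ! (length p - 1) \<in> T" using parity[of "length p - 1"] assms(3) by auto
    then have "rev p ! 0 \<in> T" using nonempty by (simp add: rev_nth)
    then show ?thesis
      using alternating_path_rev[OF assms(1)] path_covers_rev[OF assms(5)] assms(2)
      by (intro exI[of _ "rev p"]) simp
  qed
  then obtain q where q: "alternating_path S T q" "set q = S \<union> T" "path_covers q F" "q ! 0 \<in> T"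
    by blast
  show thesis
    using alternating_path_even_length[OF q(1,2) assms(3,4) q(4)]
      alternating_path_parity[OF q(1) assms(3) q(4)] by (intro that[OF q(1-3)])
qed

section \<open>Ordering the two bases along the path\<close>

theorem theorem27:
  fixes E :: "'a set" and indep :: "'a set \<Rightarrow> bool" and A B :: "'a set" and r :: nat
  assumes "matroid E indep"
    and "matroid_rank indep E = r"
    and "property_P_plus E indep"
    and "matroid_basis E indep A"
    and "matroid_basis E indep B"
  shows "\<exists>a b :: nat \<Rightarrow> 'a.
    bij_betw a {1..r} A \<and> bij_betw b {1..r} B \<and>
    (\<forall>i \<in> {1..r}. matroid_basis E indep (a ` {i..r} \<union> b ` {1..<i})) \<and>
    (\<forall>i \<in> {1..r}. matroid_rank indep (b ` {i..r} \<union> a ` {1..<i}) \<ge> r - 1)"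
proof -
  interpret matroid E indep by fact
  have AB: "A \<subseteq> E" "B \<subseteq> E" "finite A" "finite B"
    using assms(4,5) finite_indep by (auto simp: matroid_basis_def)
  have card_AB: "card A = r" "card B = r"
    using card_basis_eq_rank assms by auto
  define m k where "m = card (A \<inter> B)" and "k = card (A - B)"
  have r: "r = m + k" "card (B - A) = k"
    using AB card_AB card_Diff_subset_Int[of A B] card_Diff_subset_Int[of B A]
      card_mono[of A "A \<inter> B"] by (auto simp: m_def k_def Int_commute)
  obtain q where q: "set q = sym_diff A B" "alternating_path (A - B) (B - A) q"
    "path_covers q (circuits_in E indep (A \<union> B))"
    using assms(3-5) unfolding property_P_plus_def by blast
  have "(A - B) \<inter> (B - A) = {}" "card (A - B) = card (B - A)"
    using r(2) by (auto simp: k_def)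
  from alternating_path_from_right[OF q(2,1) this q(3), folded k_def] obtain p where p: "alternating_path (A - B) (B - A) p" "set p = (A - B) \<union> (B - A)"
    and cover: "path_covers p (circuits_in E indep (A \<union> B))"
    and len: "length p = 2 * k"
    and parity: "\<And>j. j < length p \<Longrightarrow> if even j then p ! j \<in> B - A else p ! j \<in> A - B"
    by blast
  have dist: "distinct p" using p(1) by (simp add: alternating_path_def)
  obtain c where c: "bij_betw c {1..m} (A \<inter> B)"
    using ex_bij_betw_nat_finite_1[of "A \<inter> B"] AB unfolding m_def by blast
  \<comment> \<open>The common elements get the same index in both orderings. Lists count from 0, so
    for \<open>i > m\<close> the pair \<open>b i\<close>, \<open>a i\<close> occupies positions
    \<open>2 * (i - m - 1)\<close> and its successor.\<close>
  define a where "a i = (if i \<le> m then c i else p ! (2 * (i - m - 1) + 1))" for i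
  define b where "b i = (if i \<le> m then c i else p ! (2 * (i - m - 1)))" for i

  have c_mem: "c i \<in> A \<inter> B" if "1 \<le> i" "i \<le> m" for i
    using bij_betwE[OF c] that by auto
  have c_eq: "c i = c j \<longleftrightarrow> i = j" if "1 \<le> i" "i \<le> m" "1 \<le> j" "j \<le> m" for i j
    using inj_on_eq_iff[OF bij_betw_imp_inj_on[OF c]] that by simp
  have idx: "2 * (i - m - 1) + 1 < length p" if "m < i" "i \<le> r" for i
    using that len r by linarith
  have odd_mem: "p ! (2 * (i - m - 1) + 1) \<in> A - B" if "m < i" "i \<le> r" for i
    using parity[OF idx[OF that]] by simp
  have even_mem: "p ! (2 * (i - m - 1)) \<in> B - A" if "m < i" "i \<le> r" for i
    using parity[of "2 * (i - m - 1)"] idx[OF that] by simp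
  have a_mem: "a i \<in> A" if "i \<in> {1..r}" for i
    using that c_mem odd_mem by (auto simp: a_def)
  have b_mem: "b i \<in> B" if "i \<in> {1..r}" for i
    using that c_mem even_mem by (auto simp: b_def)
  have inj_a: "inj_on a {1..r}"
  proof (rule inj_onI)
    fix i j assume ij: "i \<in> {1..r}" "j \<in> {1..r}" "a i = a j"
    show "i = j"
    proof (cases "i \<le> m"; cases "j \<le> m")
      assume "i \<le> m" "j \<le> m"
      then show ?thesis using ij c_eq by (auto simp: a_def)
    next
      assume "i \<le> m" "\<not> j \<le> m"
      then show ?thesis using ij c_mem[of i] odd_mem[of j] by (auto simp: a_def)
    next
      assume "\<not> i \<le> m" "j \<le> m"
      then show ?thesis using ij c_mem[of j] odd_mem[of i] by (auto simp: a_def)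
    next
      assume *: "\<not> i \<le> m" "\<not> j \<le> m"
      then have "2 * (i - m - 1) + 1 = 2 * (j - m - 1) + 1"
        using ij idx[of i] idx[of j] nth_eq_iff_index_eq[OF dist] by (auto simp: a_def)
      then show ?thesis using * by linarith
    qed
  qed
  have inj_b: "inj_on b {1..r}"
  proof (rule inj_onI)
    fix i j assume ij: "i \<in> {1..r}" "j \<in> {1..r}" "b i = b j"
    show "i = j"
    proof (cases "i \<le> m"; cases "j \<le> m")
      assume "i \<le> m" "j \<le> m"
      then show ?thesis using ij c_eq by (auto simp: b_def)
    next
      assume "i \<le> m" "\<not> j \<le> m"
      then show ?thesis using ij c_mem[of i] even_mem[of j] by (auto simp: b_def)
    next
      assume "\<not> i \<le> m" "j \<le> m"
      then show ?thesis using ij c_mem[of j] even_mem[of i] by (auto simp: b_def)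
    next
      assume *: "\<not> i \<le> m" "\<not> j \<le> m"
      then have "2 * (i - m - 1) = 2 * (j - m - 1)"
        using ij idx[of i] idx[of j] nth_eq_iff_index_eq[OF dist] by (auto simp: b_def)
      then show ?thesis using * by linarith
    qed
  qed
  \<comment> \<open>Equality can occur only on \<open>A \<inter> B\<close>, where both orderings are
    \<open>c\<close>. Hence disjoint index sets have disjoint images.\<close>
  have ab_eq: "i = j" if "i \<in> {1..r}" "j \<in> {1..r}" "a i = b j" for i j
    using that c_eq[of i j] c_mem[of i] c_mem[of j] even_mem[of j] odd_mem[of i]
    by (auto simp: a_def b_def split: if_splits)
  have bij_a: "bij_betw a {1..r} A"
    unfolding bij_betw_def using inj_a a_mem AB card_AB card_image[OF inj_a]
    by (intro conjI card_subset_eq image_subsetI) simp_all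
  have bij_b: "bij_betw b {1..r} B"
    unfolding bij_betw_def using inj_b b_mem AB card_AB card_image[OF inj_b]
    by (intro conjI card_subset_eq image_subsetI) simp_all

  \<comment> \<open>Positions on the path are translated back into indices; path vertices lie
    outside \<open>A \<inter> B\<close>, which rules out \<open>l \<le> m\<close>.\<close>
  have even_index: "m < l \<and> j = 2 * (l - m - 1)"
    if "p ! j = b l" "even j" "j < length p" "l \<in> {1..r}" for j l
    using that parity[of j] c_mem[of l] idx[of l] nth_eq_iff_index_eq[OF dist, of j "2 * (l - m - 1)"]
    by (auto simp: b_def split: if_splits)
  have odd_index: "m < l \<and> j = 2 * (l - m - 1) + 1"
    if "p ! j = a l" "odd j" "j < length p" "l \<in> {1..r}" for j l
    using that parity[of j] c_mem[of l] idx[of l]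
      nth_eq_iff_index_eq[OF dist, of j "2 * (l - m - 1) + 1"]
    by (auto simp: a_def split: if_splits)
  \<comment> \<open>Parity tells which ordering a path vertex comes from: even positions are in
    \<open>B - A\<close>, so not in the image of \<open>a\<close>.\<close>
  have even_in: "\<exists>l\<in>J. m < l \<and> j = 2 * (l - m - 1)"
    if h: "p ! j \<in> a ` I \<union> b ` J" "even j" "j < length p" "I \<subseteq> {1..r}" "J \<subseteq> {1..r}" for j I J
  proof -
    have "p ! j \<notin> a ` I" using h(2-4) parity[of j] a_mem by auto
    then obtain l where "l \<in> J" "p ! j = b l" using h(1) by blast
    then show ?thesis using even_index[of j l] h(2,3,5) by blast
  qed
  have odd_in: "\<exists>l\<in>I. m < l \<and> j = 2 * (l - m - 1) + 1"
    if h: "p ! j \<in> a ` I \<union> b ` J" "odd j" "j < length p" "I \<subseteq> {1..r}" "J \<subseteq> {1..r}" for j I J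
  proof -
    have "p ! j \<notin> b ` J" using h(2,3,5) parity[of j] b_mem by auto
    then obtain l where "l \<in> I" "p ! j = a l" using h(1) by blast
    then show ?thesis using odd_index[of j l] h(2-4) by blast
  qed

  \<comment> \<open>Every edge of the path joins \<open>b l\<close> to \<open>a l\<close> or
    \<open>a l\<close> to \<open>b (Suc l)\<close>. Disjointness of \<open>I\<close> and
    \<open>J\<close> excludes the first type, \<open>gap\<close> the second.\<close>
  have indep_union: "indep (a ` I \<union> b ` J)"
    if IJ: "I \<subseteq> {1..r}" "J \<subseteq> {1..r}" "I \<inter> J = {}" and gap: "\<And>l. l \<in> I \<Longrightarrow> Suc l \<notin> J" for I J
  proof (rule indep_if_edge_free[OF cover])
    show "A \<union> B \<subseteq> E" using AB by simp
    show "a ` I \<union> b ` J \<subseteq> A \<union> B" using IJ a_mem b_mem by blast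
    fix j assume j: "Suc j < length p" "p ! j \<in> a ` I \<union> b ` J" "p ! Suc j \<in> a ` I \<union> b ` J"
    show False
    proof (cases "even j")
      case True
      obtain l where l: "l \<in> J" "m < l" "j = 2 * (l - m - 1)"
        using even_in[OF j(2) True] j(1) IJ by auto
      obtain l' where l': "l' \<in> I" "m < l'" "Suc j = 2 * (l' - m - 1) + 1"
        using odd_in[OF j(3)] True j(1) IJ by auto
      have "l = l'" using l l' by linarith
      then show False using l(1) l'(1) IJ(3) by blast
    next
      case False
      obtain l where l: "l \<in> I" "m < l" "j = 2 * (l - m - 1) + 1"
        using odd_in[OF j(2) False] j(1) IJ by auto
      obtain l' where l': "l' \<in> J" "m < l'" "Suc j = 2 * (l' - m - 1)"
        using even_in[OF j(3)] False j(1) IJ by auto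
      have "l' = Suc l" using l l' by linarith
      then show False using l(1) l'(1) gap by blast
    qed
  qed
  have card_union: "card (a ` I \<union> b ` J) = card I + card J"
    if "I \<subseteq> {1..r}" "J \<subseteq> {1..r}" "I \<inter> J = {}" for I J
  proof -
    have "finite I" "finite J" using that finite_subset by blast+
    moreover have "a ` I \<inter> b ` J = {}" using that ab_eq by blast
    ultimately show ?thesis
      using that inj_on_subset[OF inj_a] inj_on_subset[OF inj_b]
      by (simp add: card_Un_disjoint card_image)
  qed

  \<comment> \<open>Here \<open>gap\<close> holds because the successor of an index at least
    \<open>i\<close> is not below \<open>i\<close>.\<close>
  have "matroid_basis E indep (a ` {i..r} \<union> b ` {1..<i})" if "i \<in> {1..r}" for i
  proof (rule basis_if_card_eq_rank)
    show "indep (a ` {i..r} \<union> b ` {1..<i})"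
      using that by (intro indep_union) auto
    show "card (a ` {i..r} \<union> b ` {1..<i}) = matroid_rank indep E"
      using that assms(2) by (subst card_union) auto
  qed
  moreover have "matroid_rank indep (b ` {i..r} \<union> a ` {1..<i}) \<ge> r - 1" if "i \<in> {1..r}" for i
  proof -
    \<comment> \<open>Starting the \<open>b\<close> part at \<open>Suc i\<close> restores
      \<open>gap\<close>: the successor of an index below \<open>i\<close> is at most
      \<open>i\<close>. The sizes \<open>i - 1\<close> and \<open>r - i\<close> add up to
      \<open>r - 1\<close>.\<close>
    have "card (a ` {1..<i} \<union> b ` {Suc i..r}) = r - 1"
      using that by (subst card_union) auto
    moreover have "indep (a ` {1..<i} \<union> b ` {Suc i..r})"
      using that by (intro indep_union) auto
    moreover have "a ` {1..<i} \<union> b ` {Suc i..r} \<subseteq> b ` {i..r} \<union> a ` {1..<i}"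
      by auto
    moreover have "b ` {i..r} \<union> a ` {1..<i} \<subseteq> E"
    proof -
      have "{i..r} \<subseteq> {1..r}" "{1..<i} \<subseteq> {1..r}" using that by auto
      then show ?thesis using a_mem b_mem AB(1,2) by blast
    qed
    ultimately show ?thesis using card_le_rank by metis
  qed
  ultimately show ?thesis using bij_a bij_b by blast
qed

end
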